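(* For any set $\Gamma$ of formulas and formula $\varphi$ of a first-order language $L$, if $\Gamma\vdash\varphi$ (i.e., $\varphi$ is provable in classical first-order logic with identity from assumptions in $\Gamma$), then for every first-order possibility model $\mathfrak{A}$ for $L$, every possibility $s$ of $\mathfrak{A}$, and every variable assignment $g$, if $\mathfrak{A},s\Vdash_g\psi$ for all $\psi\in\Gamma$, then $\mathfrak{A},s\Vdash_g\varphi$.
   Context: Let $L$ be a first-order language (with identity and function symbols; constants are $0$-ary function symbols). A first-order possibility model for $L$ is a tuple $\mathfrak{A}=(S,\sqsubseteq,D,\asymp,V)$ where $(S,\sqsubseteq)$ is a poset; $D$ is a nonempty set; $\asymp$ assigns to each $s\in S$ an equivalence relation $\asymp_s$ on $D$ such that (persistence) if $a\asymp_s b$ and $s'\sqsubseteq s$ then $a\asymp_{s'}b$, and (refinability) if $a\not\asymp_s b$ then $\exists s'\sqsubseteq s\ \forall s''\sqsubseteq s'\ a\not\asymp_{s''}b$; $V$ assigns to each $n$-ary predicate $R$ and $s\in S$ a set $V(R,s)\subseteq D^n$ and to each $n$-ary function symbol $f$ and $s$ a set $V(f,s)\subseteq D^{n+1}$ such that: (persistence for $R$) if $\overline a\in V(R,s)$, $s'\sqsubseteq s$ and $\overline a\asymp_{s'}\overline b$ (componentwise), then $\overline b\in V(R,s')$; (refinability for $R$) if $\overline a\notin V(R,s)$ then $\exists s'\sqsubseteq s\ \forall s''\sqsubseteq s'\ \overline a\notin V(R,s'')$; (persistence for $f$) likewise with $V(f,\cdot)$; (quasi-functionality) if $(\overline a,b),(\overline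 a,b')\in V(f,s)$ then $b\asymp_s b'$; (eventual definedness) for all $\overline a\in D^n$ there are $s'\sqsubseteq s$ and $b\in D$ with $(\overline a,b)\in V(f,s')$. For $s\in S$ and an assignment $g$ of elements of $D$ to variables, the denotation $\mathrm{den}_{\mathfrak{A},s,g}(t)\subseteq D$ of a term $t$ is defined by: $\mathrm{den}_{\mathfrak{A},s,g}(x)=\{a\in D\mid a\asymp_s g(x)\}$ for a variable $x$, and $\mathrm{den}_{\mathfrak{A},s,g}(f(t_1,\dots,t_n))=\{b\in D\mid \exists a_1,\dots,a_n$ with $a_i\in\mathrm{den}_{\mathfrak{A},s,g}(t_i)$ and $(a_1,\dots,a_n,b)\in V(f,s)\}$. For $\asymp_s$-classes $\xi_1,\dots,\xi_n$, say $(\xi_1,\dots,\xi_n)\in I_\asymp(R,s)$ iff there are $a_i\in\xi_i$ with $(a_1,\dots,a_n)\in V(R,s)$. Satisfaction: $\mathfrak{A},s\Vdash_g t_1=t_2$ iff for all $s'\sqsubseteq s$, if each $\mathrm{den}_{\mathfrak{A},s',g}(t_i)$ is nonempty then $\mathrm{den}_{\mathfrak{A},s',g}(t_1)=\mathrm{den}_{\mathfrak{A},s',g}(t_2)$; $\mathfrak{A},s\Vdash_g R(t_1,\dots,t_n)$ iff for all $s'\sqsubseteq s$, if each $\mathrm{den}_{\mathfrak{A},s',g}(t_i)$ is nonempty then $(\mathrm{den}_{\mathfrak{A},s',g}(t_1),\dots,\mathrm{den}_{\mathfrak{A},s',g}(t_n))\in I_\asymp(R,s')$; $\mathfrak{A},s\Vdash_g\neg\varphi$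 iff for all $s'\sqsubseteq s$, $\mathfrak{A},s'\nVdash_g\varphi$; $\mathfrak{A},s\Vdash_g\varphi\wedge\psi$ iff both conjuncts hold; $\mathfrak{A},s\Vdash_g\forall x\varphi$ iff for all $a\in D$, $\mathfrak{A},s\Vdash_{g[x:=a]}\varphi$. Other connectives and $\exists$ are defined classically. *)

theory Defs
  imports Main "HOL-Library.NList"
begin

text \<open>Variables are natural numbers. Disjunction, implication and \<open>\<exists>\<close> are not constructors:
  they are the usual classical abbreviations in terms of \<open>\<not>\<close>, \<open>\<and>\<close> and \<open>\<forall>\<close>.\<close>

datatype 'f trm = Var nat | Fn 'f "'f trm list"

datatype ('f, 'p) form =
    Eq "'f trm" "'f trm"
  | Rel 'p "'f trm list"
  | Neg "('f, 'p) form"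
  | Conj "('f, 'p) form" "('f, 'p) form"
  | All nat "('f, 'p) form"

text \<open>The symbols of a language form arbitrary, possibly empty, sets; arities are only relevant
  for symbols in these sets.\<close>

record ('f, 'p) language =
  funs :: "'f set"
  preds :: "'p set"
  farity :: "'f \<Rightarrow> nat"
  parity :: "'p \<Rightarrow> nat"

fun is_trm :: "('f, 'p) language \<Rightarrow> 'f trm \<Rightarrow> bool" where
  "is_trm L (Var x) \<longleftrightarrow> True"
| "is_trm L (Fn f ts) \<longleftrightarrow> f \<in> funs L \<and> length ts = farity L f \<and> (\<forall>t\<in>set ts. is_trm L t)"

primrec is_form :: "('f, 'p) language \<Rightarrow> ('f, 'p) form \<Rightarrow> bool" where
  "is_form L (Eq t u) \<longleftrightarrow> is_trm L t \<and> is_trm L u"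
| "is_form L (Rel R ts) \<longleftrightarrow> R \<in> preds L \<and> length ts = parity L R \<and> (\<forall>t\<in>set ts. is_trm L t)"
| "is_form L (Neg \<phi>) \<longleftrightarrow> is_form L \<phi>"
| "is_form L (Conj \<phi> \<psi>) \<longleftrightarrow> is_form L \<phi> \<and> is_form L \<psi>"
| "is_form L (All x \<phi>) \<longleftrightarrow> is_form L \<phi>"


section \<open>Classical first-order logic with identity\<close>

fun vars :: "'f trm \<Rightarrow> nat set" where
  "vars (Var x) = {x}"
| "vars (Fn f ts) = (\<Union>t\<in>set ts. vars t)"

primrec fv :: "('f, 'p) form \<Rightarrow> nat set" where
  "fv (Eq t u) = vars t \<union> vars u"
| "fv (Rel R ts) = (\<Union>t\<in>set ts. vars t)"
| "fv (Neg \<phi>) = fv \<phi>"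
| "fv (Conj \<phi> \<psi>) = fv \<phi> \<union> fv \<psi>"
| "fv (All x \<phi>) = fv \<phi> - {x}"

primrec tsubst :: "nat \<Rightarrow> 'f trm \<Rightarrow> 'f trm \<Rightarrow> 'f trm" where
  "tsubst x t (Var y) = (if y = x then t else Var y)"
| "tsubst x t (Fn f ts) = Fn f (map (tsubst x t) ts)"

text \<open>\<open>subst x t \<phi>\<close> replaces the free occurrences of \<open>x\<close> in \<open>\<phi>\<close> by \<open>t\<close> without renaming bound
  variables; \<open>free_for t x \<phi>\<close> excludes variable capture.\<close>

primrec subst :: "nat \<Rightarrow> 'f trm \<Rightarrow> ('f, 'p) form \<Rightarrow> ('f, 'p) form" where
  "subst x t (Eq u v) = Eq (tsubst x t u) (tsubst x t v)"
| "subst x t (Rel R ts) = Rel R (map (tsubst x t) ts)"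
| "subst x t (Neg \<phi>) = Neg (subst x t \<phi>)"
| "subst x t (Conj \<phi> \<psi>) = Conj (subst x t \<phi>) (subst x t \<psi>)"
| "subst x t (All y \<phi>) = (if y = x then All y \<phi> else All y (subst x t \<phi>))"

primrec free_for :: "'f trm \<Rightarrow> nat \<Rightarrow> ('f, 'p) form \<Rightarrow> bool" where
  "free_for t x (Eq u v) \<longleftrightarrow> True"
| "free_for t x (Rel R ts) \<longleftrightarrow> True"
| "free_for t x (Neg \<phi>) \<longleftrightarrow> free_for t x \<phi>"
| "free_for t x (Conj \<phi> \<psi>) \<longleftrightarrow> free_for t x \<phi> \<and> free_for t x \<psi>"
| "free_for t x (All y \<phi>) \<longleftrightarrow> x \<notin> fv (All y \<phi>) \<or> (y \<notin> vars t \<and> free_for t x \<phi>)"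

text \<open>Natural deduction for the primitive connectives.\<close>

inductive nd :: "('f, 'p) language \<Rightarrow> ('f, 'p) form set \<Rightarrow> ('f, 'p) form \<Rightarrow> bool" for L where
  Assm: "\<phi> \<in> \<Gamma> \<Longrightarrow> nd L \<Gamma> \<phi>"
| NegI: "is_form L \<phi> \<Longrightarrow> nd L (insert \<phi> \<Gamma>) \<psi> \<Longrightarrow> nd L (insert \<phi> \<Gamma>) (Neg \<psi>) \<Longrightarrow> nd L \<Gamma> (Neg \<phi>)"
| RAA: "is_form L \<phi> \<Longrightarrow> nd L (insert (Neg \<phi>) \<Gamma>) \<psi> \<Longrightarrow> nd L (insert (Neg \<phi>) \<Gamma>) (Neg \<psi>) \<Longrightarrow> nd L \<Gamma> \<phi>"
| ConjI: "nd L \<Gamma> \<phi> \<Longrightarrow> nd L \<Gamma> \<psi> \<Longrightarrow> nd L \<Gamma> (Conj \<phi> \<psi>)"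
| ConjE1: "nd L \<Gamma> (Conj \<phi> \<psi>) \<Longrightarrow> nd L \<Gamma> \<phi>"
| ConjE2: "nd L \<Gamma> (Conj \<phi> \<psi>) \<Longrightarrow> nd L \<Gamma> \<psi>"
| AllI: "nd L \<Gamma> (subst x (Var y) \<phi>) \<Longrightarrow> free_for (Var y) x \<phi> \<Longrightarrow>
    y \<notin> fv (All x \<phi>) \<Longrightarrow> \<forall>\<psi>\<in>\<Gamma>. y \<notin> fv \<psi> \<Longrightarrow> nd L \<Gamma> (All x \<phi>)"
| AllE: "nd L \<Gamma> (All x \<phi>) \<Longrightarrow> is_trm L t \<Longrightarrow> free_for t x \<phi> \<Longrightarrow> nd L \<Gamma> (subst x t \<phi>)"
| EqI: "is_trm L t \<Longrightarrow> nd L \<Gamma> (Eq t t)"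
| EqE: "nd L \<Gamma> (Eq t u) \<Longrightarrow> nd L \<Gamma> (subst x t \<phi>) \<Longrightarrow> free_for t x \<phi> \<Longrightarrow> free_for u x \<phi> \<Longrightarrow>
    nd L \<Gamma> (subst x u \<phi>)"

text \<open>Only finitely many assumptions are used, so the eigenvariable condition of \<open>AllI\<close> is never
  obstructed by an infinite \<open>\<Gamma>\<close> in which every variable occurs free.\<close>

definition provable :: "('f, 'p) language \<Rightarrow> ('f, 'p) form set \<Rightarrow> ('f, 'p) form \<Rightarrow> bool" where
  "provable L \<Gamma> \<phi> \<longleftrightarrow> (\<exists>\<Gamma>\<^sub>0. finite \<Gamma>\<^sub>0 \<and> \<Gamma>\<^sub>0 \<subseteq> \<Gamma> \<and> nd L \<Gamma>\<^sub>0 \<phi>)"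


section \<open>First-order possibility models\<close>

text \<open>\<open>(s', s) \<in> ref A\<close> means that \<open>s'\<close> refines \<open>s\<close>, and \<open>(a, b) \<in> asymp A s\<close> means
  \<open>a \<asymp>\<^sub>s b\<close>. Tuples in \<open>D\<^sup>n\<close> are lists of length \<open>n\<close>; a pair of \<open>as \<in> D\<^sup>n\<close> and \<open>b \<in> D\<close> is
  represented in \<open>D\<^sup>n\<^sup>+\<^sup>1\<close> by \<open>as @ [b]\<close>.\<close>

record ('s, 'd, 'f, 'p) pmodel =
  poss :: "'s set"
  ref :: "('s \<times> 's) set"
  dom :: "'d set"
  asymp :: "'s \<Rightarrow> ('d \<times> 'd) set"
  predval :: "'p \<Rightarrow> 's \<Rightarrow> 'd list set"
  funval :: "'f \<Rightarrow> 's \<Rightarrow> 'd list set"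

abbreviation asymps :: "('s, 'd, 'f, 'p) pmodel \<Rightarrow> 's \<Rightarrow> 'd list \<Rightarrow> 'd list \<Rightarrow> bool" where
  "asymps A s \<equiv> list_all2 (\<lambda>a b. (a, b) \<in> asymp A s)"

locale possibility_model =
  fixes L :: "('f, 'p) language"
    and A :: "('s, 'd, 'f, 'p) pmodel"
  assumes poset: "partial_order_on (poss A) (ref A)"
    and dom_nonempty: "dom A \<noteq> {}"
    and asymp_equiv: "s \<in> poss A \<Longrightarrow> equiv (dom A) (asymp A s)"
    and asymp_persistence:
      "\<lbrakk>(a, b) \<in> asymp A s; (s', s) \<in> ref A\<rbrakk> \<Longrightarrow> (a, b) \<in> asymp A s'"
    and asymp_refinability:
      "\<lbrakk>s \<in> poss A; a \<in> dom A; b \<in> dom A; (a, b) \<notin> asymp A s\<rbrakk> \<Longrightarrow>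
        \<exists>s'. (s', s) \<in> ref A \<and> (\<forall>s''. (s'', s') \<in> ref A \<longrightarrow> (a, b) \<notin> asymp A s'')"
    and pred_tuples:
      "\<lbrakk>R \<in> preds L; s \<in> poss A\<rbrakk> \<Longrightarrow> predval A R s \<subseteq> nlists (parity L R) (dom A)"
    and fun_tuples:
      "\<lbrakk>f \<in> funs L; s \<in> poss A\<rbrakk> \<Longrightarrow> funval A f s \<subseteq> nlists (farity L f + 1) (dom A)"
    and pred_persistence:
      "\<lbrakk>R \<in> preds L; as \<in> predval A R s; (s', s) \<in> ref A; asymps A s' as bs\<rbrakk> \<Longrightarrow>
        bs \<in> predval A R s'"
    and pred_refinability:
      "\<lbrakk>R \<in> preds L; s \<in> poss A; as \<in> nlists (parity L R) (dom A); as \<notin> predval A R s\<rbrakk> \<Longrightarrow>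
        \<exists>s'. (s', s) \<in> ref A \<and> (\<forall>s''. (s'', s') \<in> ref A \<longrightarrow> as \<notin> predval A R s'')"
    and fun_persistence:
      "\<lbrakk>f \<in> funs L; cs \<in> funval A f s; (s', s) \<in> ref A; asymps A s' cs ds\<rbrakk> \<Longrightarrow>
        ds \<in> funval A f s'"
    and quasi_functionality:
      "\<lbrakk>f \<in> funs L; s \<in> poss A; as @ [b] \<in> funval A f s; as @ [b'] \<in> funval A f s\<rbrakk> \<Longrightarrow>
        (b, b') \<in> asymp A s"
    and eventual_definedness:
      "\<lbrakk>f \<in> funs L; s \<in> poss A; as \<in> nlists (farity L f) (dom A)\<rbrakk> \<Longrightarrow>
        \<exists>s' b. (s', s) \<in> ref A \<and> b \<in> dom A \<and> as @ [b] \<in> funval A f s'"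

primrec den :: "('s, 'd, 'f, 'p) pmodel \<Rightarrow> 's \<Rightarrow> (nat \<Rightarrow> 'd) \<Rightarrow> 'f trm \<Rightarrow> 'd set" where
  "den A s g (Var x) = {a \<in> dom A. (a, g x) \<in> asymp A s}"
| "den A s g (Fn f ts) =
    {b \<in> dom A. \<exists>as. list_all2 (\<in>) as (map (den A s g) ts) \<and> as @ [b] \<in> funval A f s}"

definition pred_int :: "('s, 'd, 'f, 'p) pmodel \<Rightarrow> 'p \<Rightarrow> 's \<Rightarrow> 'd set list set" where
  "pred_int A R s =
    {\<xi>s. set \<xi>s \<subseteq> dom A // asymp A s \<and> (\<exists>as. list_all2 (\<in>) as \<xi>s \<and> as \<in> predval A R s)}"

fun sat :: "('s, 'd, 'f, 'p) pmodel \<Rightarrow> 's \<Rightarrow> (nat \<Rightarrow> 'd) \<Rightarrow> ('f, 'p) form \<Rightarrow> bool" where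
  "sat A s g (Eq t u) \<longleftrightarrow>
    (\<forall>s'. (s', s) \<in> ref A \<longrightarrow> den A s' g t \<noteq> {} \<and> den A s' g u \<noteq> {} \<longrightarrow>
      den A s' g t = den A s' g u)"
| "sat A s g (Rel R ts) \<longleftrightarrow>
    (\<forall>s'. (s', s) \<in> ref A \<longrightarrow> (\<forall>t\<in>set ts. den A s' g t \<noteq> {}) \<longrightarrow>
      map (den A s' g) ts \<in> pred_int A R s')"
| "sat A s g (Neg \<phi>) \<longleftrightarrow> (\<forall>s'. (s', s) \<in> ref A \<longrightarrow> \<not> sat A s' g \<phi>)"
| "sat A s g (Conj \<phi> \<psi>) \<longleftrightarrow> sat A s g \<phi> \<and> sat A s g \<psi>"
| "sat A s g (All x \<phi>) \<longleftrightarrow> (\<forall>a\<in>dom A. sat A s (g(x := a)) \<phi>)"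

end

theory Submission
  imports Defs
begin

text \<open>
  At a possibility where it is nonempty, the denotation of a term is a single \<open>\<asymp>\<close>-class which
  persists under refinement, and every possibility has a refinement at which a given term denotes.
  Forcing is persistent and refinable (a formula forced densely below \<open>s\<close> is forced at \<open>s\<close>), which
  gives the classical propositional rules. Wherever \<open>t\<close> denotes, instantiating \<open>x\<close> by \<open>t\<close> amounts
  to assigning to \<open>x\<close> any element of the denotation of \<open>t\<close>; by refinability the quantifier and
  identity rules need only be checked at such possibilities.
\<close>

section \<open>Substitution and well-formedness\<close>

lemma tsubst_not_in_vars: "x \<notin> vars v \<Longrightarrow> tsubst x t v = v"
  by (induction v) (auto intro!: map_idI)

lemma subst_not_in_fv: "x \<notin> fv \<phi> \<Longrightarrow> subst x t \<phi> = \<phi>"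
  by (induction \<phi>) (auto simp: tsubst_not_in_vars intro!: map_idI)

lemma is_trm_tsubst: "is_trm L t \<Longrightarrow> is_trm L (tsubst x t v) \<longleftrightarrow> is_trm L v"
  by (induction v) auto

lemma is_form_subst: "is_trm L t \<Longrightarrow> is_form L (subst x t \<phi>) \<longleftrightarrow> is_form L \<phi>"
  by (induction \<phi>) (auto simp: is_trm_tsubst)

text \<open>Refinability of forcing is available only for well-formed formulas, so derivations must
  be shown to stay among them. Rules that discharge an assumption check its well-formedness, which
  keeps the induction hypothesis applicable; \<open>AllI\<close> and \<open>EqE\<close> also use
  \<open>is_form_subst\<close> backwards, from an instance to \<open>\<phi>\<close>.\<close>

lemma nd_is_form:
  assumes "nd L \<Gamma> \<phi>" and "\<forall>\<psi>\<in>\<Gamma>. is_form L \<psi>"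
  shows "is_form L \<phi>"
  using assms by (induction rule: nd.induct) (auto simp: is_form_subst)

section \<open>Denotations and forcing\<close>

lemma den_cong: "\<forall>x\<in>vars t. g x = h x \<Longrightarrow> den A s g t = den A s h t"
proof (induction t)
  case (Fn f ts)
  then have "map (den A s g) ts = map (den A s h) ts"
    by auto
  then show ?case
    by (simp only: den.simps)
qed simp

lemma sat_cong: "\<forall>x\<in>fv \<phi>. g x = h x \<Longrightarrow> sat A s g \<phi> = sat A s h \<phi>"
proof (induction \<phi> arbitrary: s g h)
  case (Eq t u)
  then have "den A s' g t = den A s' h t" "den A s' g u = den A s' h u" for s'
    by (auto intro!: den_cong)
  then show ?case
    by simp
next
  case (Rel R ts)
  then have eq: "den A s' g t = den A s' h t" if "t \<in> set ts" for s' t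
    using that by (auto intro!: den_cong)
  then have "map (den A s' g) ts = map (den A s' h) ts" for s'
    by simp
  moreover have "(\<forall>t\<in>set ts. den A s' g t \<noteq> {}) = (\<forall>t\<in>set ts. den A s' h t \<noteq> {})" for s'
    using eq by simp
  ultimately show ?case
    by (simp only: sat.simps)
next
  case (Neg \<phi>)
  then show ?case
    by (metis fv.simps(3) sat.simps(3))
next
  case (Conj \<phi> \<psi>)
  then show ?case
    by (metis Un_iff fv.simps(4) sat.simps(4))
next
  case (All x \<phi>)
  then have "sat A s (g(x := a)) \<phi> = sat A s (h(x := a)) \<phi>" for a
    by (intro All.IH) auto
  then show ?case
    by simp
qed

context possibility_model
begin

section \<open>Order and equivalence facts read off the model axioms\<close>

lemma ref_poss: "(s', s) \<in> ref A \<Longrightarrow> s' \<in> poss A \<and> s \<in> poss A"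
  using poset by (auto simp: partial_order_on_def preorder_on_def)

lemma ref_refl: "s \<in> poss A \<Longrightarrow> (s, s) \<in> ref A"
  using poset by (auto simp: partial_order_on_def preorder_on_def refl_on_def)

lemma ref_trans: "(s'', s') \<in> ref A \<Longrightarrow> (s', s) \<in> ref A \<Longrightarrow> (s'', s) \<in> ref A"
  using poset by (auto simp: partial_order_on_def preorder_on_def dest: transD)

lemma asymp_dom: "s \<in> poss A \<Longrightarrow> (a, b) \<in> asymp A s \<Longrightarrow> a \<in> dom A \<and> b \<in> dom A"
  using asymp_equiv by (auto simp: equiv_def)

lemma asymp_refl: "s \<in> poss A \<Longrightarrow> a \<in> dom A \<Longrightarrow> (a, a) \<in> asymp A s"
  using asymp_equiv by (auto simp: equiv_def refl_on_def)

lemma asymp_sym: "s \<in> poss A \<Longrightarrow> (a, b) \<in> asymp A s \<Longrightarrow> (b, a) \<in> asymp A s"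
  using asymp_equiv by (meson equivE symE)

lemma asymp_trans:
  "s \<in> poss A \<Longrightarrow> (a, b) \<in> asymp A s \<Longrightarrow> (b, c) \<in> asymp A s \<Longrightarrow> (a, c) \<in> asymp A s"
  using asymp_equiv by (meson equivE transE)

section \<open>Denotations of terms\<close>

lemma den_dom: "a \<in> den A s g t \<Longrightarrow> a \<in> dom A"
  by (cases t) auto

lemma asymps_refl: "s \<in> poss A \<Longrightarrow> set as \<subseteq> dom A \<Longrightarrow> asymps A s as as"
  by (auto simp: list_all2_same intro: asymp_refl)

lemma dens_dom: "list_all2 (\<in>) as (map (den A s g) ts) \<Longrightarrow> set as \<subseteq> dom A"
  unfolding list_all2_map2 by (induction as ts rule: list_all2_induct) (auto dest: den_dom)

text \<open>Refinement and passage to an equivalent element are treated together, as in the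
  persistence axiom for functions: \<open>s' = s\<close> gives closure under the equivalence,
  \<open>b = a\<close> gives monotonicity.\<close>

lemma den_persistence:
  assumes "is_trm L t" and "a \<in> den A s g t" and "(s', s) \<in> ref A" and "(a, b) \<in> asymp A s'"
  shows "b \<in> den A s' g t"
  using assms
proof (induction t arbitrary: a b)
  case (Var x)
  then have "s' \<in> poss A"
    using ref_poss by blast
  moreover from Var have "(a, g x) \<in> asymp A s'"
    using asymp_persistence by auto
  ultimately show ?case
    using Var.prems(4) by (auto dest: asymp_dom intro: asymp_trans asymp_sym)
next
  case (Fn f ts)
  then obtain as where as: "list_all2 (\<in>) as (map (den A s g) ts)" "as @ [a] \<in> funval A f s"
    by auto
  have s': "s' \<in> poss A"
    using Fn.prems ref_poss by blast
  \<comment> \<open>The argument values stay fixed, so the induction hypothesis is applied to the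
    pair \<open>(a', a')\<close>; only the last coordinate changes, from \<open>a\<close> to
    \<open>b\<close>.\<close>
  have "a' \<in> den A s' g t" if "t \<in> set ts" "a' \<in> den A s g t" for a' t
    using Fn.IH[OF that(1) _ that(2) Fn.prems(3) asymp_refl[OF s']] Fn.prems(1) that den_dom
    by auto
  with as(1) have "list_all2 (\<in>) as (map (den A s' g) ts)"
    by (auto simp: list_all2_conv_all_nth)
  moreover have "asymps A s' (as @ [a]) (as @ [b])"
    using asymps_refl[OF s' dens_dom[OF as(1)]] Fn.prems(4) by (simp add: list_all2_appendI)
  then have "as @ [b] \<in> funval A f s'"
    using fun_persistence as(2) Fn.prems by auto
  ultimately show ?case
    using asymp_dom[OF s' Fn.prems(4)] by auto
qed

lemma den_mono:
  assumes "is_trm L t" and "a \<in> den A s g t" and "(s', s) \<in> ref A"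
  shows "a \<in> den A s' g t"
  using assms den_persistence asymp_refl den_dom ref_poss by metis

text \<open>The pairwise condition is a premise so that the induction hypothesis can supply it in
  the proof of \<open>den_quasi_functional\<close>; \<open>dens_asymps\<close> discharges it
  afterwards.\<close>

lemma dens_asymps_if_den:
  assumes "\<And>t a b. t \<in> set ts \<Longrightarrow> a \<in> den A s g t \<Longrightarrow> b \<in> den A s g t \<Longrightarrow> (a, b) \<in> asymp A s"
    and "list_all2 (\<in>) as (map (den A s g) ts)" and "list_all2 (\<in>) bs (map (den A s g) ts)"
  shows "asymps A s as bs"
proof (rule list_all2_all_nthI)
  have len: "length as = length ts" "length bs = length ts"
    using assms(2,3) by (simp_all add: list_all2_conv_all_nth)
  then show "length as = length bs"
    by simp
  fix i assume "i < length as"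
  then show "(as ! i, bs ! i) \<in> asymp A s"
    using list_all2_nthD[OF assms(2), of i] list_all2_nthD[OF assms(3), of i] len
    by (intro assms(1)[of "ts ! i"]) simp_all
qed

lemma den_quasi_functional:
  assumes "is_trm L t" and "s \<in> poss A" and "a \<in> den A s g t" and "b \<in> den A s g t"
  shows "(a, b) \<in> asymp A s"
  using assms
proof (induction t arbitrary: a b)
  case (Var x)
  then show ?case
    by (auto intro: asymp_trans asymp_sym)
next
  case (Fn f ts)
  then obtain as bs where
    as: "list_all2 (\<in>) as (map (den A s g) ts)" "as @ [a] \<in> funval A f s" and
    bs: "list_all2 (\<in>) bs (map (den A s g) ts)" "bs @ [b] \<in> funval A f s" and
    "a \<in> dom A"
    by auto
  have "asymps A s as bs"
    using Fn.IH Fn.prems(1,2) by (intro dens_asymps_if_den[OF _ as(1) bs(1)]) simp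
  \<comment> \<open>Persistence from \<open>s\<close> to itself replaces the arguments
    \<open>as\<close> by \<open>bs\<close>. Then \<open>a\<close> and \<open>b\<close> are both
    values at \<open>bs\<close>, and quasi-functionality compares them.\<close>
  then have "asymps A s (as @ [a]) (bs @ [a])"
    using asymp_refl \<open>a \<in> dom A\<close> Fn.prems(2) by (simp add: list_all2_appendI)
  then have "bs @ [a] \<in> funval A f s"
    using fun_persistence as(2) Fn.prems(1,2) ref_refl by auto
  then show ?case
    using quasi_functionality bs(2) Fn.prems(1,2) by auto
qed

lemma den_eq_class:
  assumes "is_trm L t" and "s \<in> poss A" and "a \<in> den A s g t"
  shows "den A s g t = asymp A s `` {a}"
  using assms den_persistence den_quasi_functional ref_refl by blast

lemma dens_asymps:
  assumes "\<forall>t\<in>set ts. is_trm L t" and "s \<in> poss A"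
    and "list_all2 (\<in>) as (map (den A s g) ts)" and "list_all2 (\<in>) bs (map (den A s g) ts)"
  shows "asymps A s as bs"
  using assms(1,2) den_quasi_functional by (intro dens_asymps_if_den[OF _ assms(3,4)]) blast

text \<open>The terms are made to denote one after another, each at a further refinement;
  \<open>den_mono\<close> preserves what was reached before. The third premise is what the induction
  on terms supplies below.\<close>

lemma dens_eventually_nonempty:
  assumes "s \<in> poss A" and "\<forall>t\<in>set ts. is_trm L t"
    and "\<And>t s. t \<in> set ts \<Longrightarrow> s \<in> poss A \<Longrightarrow> \<exists>s'. (s', s) \<in> ref A \<and> den A s' g t \<noteq> {}"
  shows "\<exists>s' as. (s', s) \<in> ref A \<and> list_all2 (\<in>) as (map (den A s' g) ts)"
  using assms
proof (induction ts arbitrary: s)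
  case Nil
  then show ?case
    using ref_refl by auto
next
  case (Cons t ts)
  then obtain s' a where s': "(s', s) \<in> ref A" "a \<in> den A s' g t"
    by (metis all_not_in_conv list.set_intros(1))
  then obtain s'' as where s'': "(s'', s') \<in> ref A" "list_all2 (\<in>) as (map (den A s'' g) ts)"
    using Cons.IH[of s'] Cons.prems ref_poss by (metis list.set_intros(2))
  have "list_all2 (\<in>) (a # as) (map (den A s'' g) (t # ts))"
    using s' s'' den_mono Cons.prems(2) by simp
  then show ?case
    using s'(1) s''(1) ref_trans by blast
qed

lemma den_eventually_nonempty:
  assumes "is_trm L t" and "s \<in> poss A" and "\<forall>x. g x \<in> dom A"
  shows "\<exists>s'. (s', s) \<in> ref A \<and> den A s' g t \<noteq> {}"
  using assms(1,2)
proof (induction t arbitrary: s)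
  case (Var x)
  then have "g x \<in> den A s g (Var x)"
    using assms(3) asymp_refl by simp
  then show ?case
    using ref_refl Var by blast
next
  case (Fn f ts)
  then obtain s' as where s': "(s', s) \<in> ref A" "list_all2 (\<in>) as (map (den A s' g) ts)"
    using dens_eventually_nonempty[of s ts g] by auto
  have "as \<in> nlists (farity L f) (dom A)"
    using dens_dom[OF s'(2)] list_all2_lengthD[OF s'(2)] Fn.prems(1) by (intro nlistsI) simp_all
  then obtain s'' b where s'': "(s'', s') \<in> ref A" "b \<in> dom A" "as @ [b] \<in> funval A f s''"
    using eventual_definedness s'(1) ref_poss Fn.prems(1) by (metis is_trm.simps(2))
  \<comment> \<open>A value at \<open>as\<close> may exist only at \<open>s''\<close>, so the
    arguments are carried down to it.\<close>
  have "list_all2 (\<in>) as (map (den A s'' g) ts)"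
    using s'(2) s''(1) den_mono Fn.prems(1) by (auto simp: list_all2_conv_all_nth)
  then have "b \<in> den A s'' g (Fn f ts)"
    using s'' by auto
  then show ?case
    using s'(1) s''(1) ref_trans by blast
qed

section \<open>Persistence and refinability of forcing\<close>

lemma sat_persistence:
  assumes "sat A s g \<phi>" and "(s', s) \<in> ref A"
  shows "sat A s' g \<phi>"
  using assms by (induction \<phi> arbitrary: g) (auto intro: ref_trans)

text \<open>In the atomic cases a failure at some \<open>s'\<close> would, by the refinability
  axioms of the model, persist at every refinement of some \<open>s1\<close> below
  \<open>s'\<close>, whereas the formula is forced somewhere below \<open>s1\<close>.\<close>

lemma sat_refinability:
  assumes "is_form L \<phi>" and "s \<in> poss A" and "\<forall>x. g x \<in> dom A"
    and "\<And>s'. (s', s) \<in> ref A \<Longrightarrow> \<exists>s''. (s'', s') \<in> ref A \<and> sat A s'' g \<phi>"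
  shows "sat A s g \<phi>"
  using assms
proof (induction \<phi> arbitrary: g)
  case (Eq t u)
  have "den A s' g t = den A s' g u"
    if s': "(s', s) \<in> ref A" and a: "a \<in> den A s' g t" and b: "b \<in> den A s' g u" for s' a b
  proof -
    have s'_poss: "s' \<in> poss A"
      using s' ref_poss by blast
    have "(a, b) \<in> asymp A s'"
    proof (rule ccontr)
      assume "(a, b) \<notin> asymp A s'"
      then obtain s1 where s1: "(s1, s') \<in> ref A"
        "\<And>r. (r, s1) \<in> ref A \<Longrightarrow> (a, b) \<notin> asymp A r"
        using asymp_refinability s'_poss a b den_dom by metis
      obtain s2 where s2: "(s2, s1) \<in> ref A" "sat A s2 g (Eq t u)"
        using Eq.prems(4) s1(1) s' ref_trans by blast
      have "s2 \<in> poss A" "(s2, s') \<in> ref A"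
        using s2 s1 ref_trans ref_poss by blast+
      moreover from this have "a \<in> den A s2 g t" "b \<in> den A s2 g u"
        using a b den_mono Eq.prems(1) by auto
      \<comment> \<open>Both terms still denote at \<open>s2\<close>, so the equation forced there
        really identifies their denotations.\<close>
      ultimately have "b \<in> den A s2 g t" "a \<in> den A s2 g t"
        using s2(2) ref_refl by auto
      then have "(a, b) \<in> asymp A s2"
        using den_quasi_functional \<open>s2 \<in> poss A\<close> Eq.prems(1) by auto
      then show False
        using s1(2) s2(1) by blast
    qed
    then have "b \<in> den A s' g t"
      using a den_persistence s'_poss ref_refl Eq.prems(1) by auto
    then show ?thesis
      using b den_eq_class s'_poss Eq.prems(1) by (metis is_form.simps(1))
  qed
  then show ?case
    by auto
next
  case (Rel R ts)
  have trms: "\<forall>t\<in>set ts. is_trm L t" and R: "R \<in> preds L"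
    using Rel.prems(1) by auto
  have "map (den A s' g) ts \<in> pred_int A R s'"
    if s': "(s', s) \<in> ref A" and ne: "\<forall>t\<in>set ts. den A s' g t \<noteq> {}" for s'
  proof -
    have s'_poss: "s' \<in> poss A"
      using s' ref_poss by blast
    \<comment> \<open>One representative is chosen from each denotation; it suffices to refute
      failure of \<open>R\<close> at this tuple.\<close>
    define as where "as = map (\<lambda>t. SOME a. a \<in> den A s' g t) ts"
    have as: "list_all2 (\<in>) as (map (den A s' g) ts)"
      using ne by (auto simp: as_def list_all2_conv_all_nth some_in_eq)
    have "as \<in> predval A R s'"
    proof (rule ccontr)
      assume "as \<notin> predval A R s'"
      moreover have "as \<in> nlists (parity L R) (dom A)"
        using dens_dom[OF as] Rel.prems(1) list_all2_lengthD[OF as] by (intro nlistsI) simp_all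
      ultimately obtain s1 where s1: "(s1, s') \<in> ref A"
        "\<And>r. (r, s1) \<in> ref A \<Longrightarrow> as \<notin> predval A R r"
        using pred_refinability[OF R s'_poss] by blast
      obtain s2 where s2: "(s2, s1) \<in> ref A" "sat A s2 g (Rel R ts)"
        using Rel.prems(4) s1(1) s' ref_trans by blast
      have s2': "s2 \<in> poss A" "(s2, s') \<in> ref A"
        using s2 s1 ref_trans ref_poss by blast+
      have as2: "list_all2 (\<in>) as (map (den A s2 g) ts)"
        using as den_mono s2'(2) trms by (auto simp: list_all2_conv_all_nth)
      have "\<forall>t\<in>set ts. den A s2 g t \<noteq> {}"
        using ne trms den_mono s2'(2) by blast
      then obtain bs where "list_all2 (\<in>) bs (map (den A s2 g) ts)" "bs \<in> predval A R s2"
        using s2(2) ref_refl[OF s2'(1)] unfolding pred_int_def sat.simps by blast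
      \<comment> \<open>The tuple \<open>bs\<close> witnessing \<open>R\<close> at \<open>s2\<close>
        may differ from \<open>as\<close>, but it is coordinatewise equivalent to it.\<close>
      then have "as \<in> predval A R s2"
        using pred_persistence[OF R] dens_asymps[OF trms s2'(1)] as2 ref_refl s2'(1) by blast
      then show False
        using s1(2) s2(1) by blast
    qed
    \<comment> \<open>\<open>pred_int\<close> also demands that every denotation be an equivalence
      class.\<close>
    moreover have "den A s' g t \<in> dom A // asymp A s'" if t: "t \<in> set ts" for t
    proof -
      obtain a where "a \<in> den A s' g t"
        using ne t by blast
      then show ?thesis
        using den_eq_class s'_poss trms t den_dom quotientI by metis
    qed
    ultimately show ?thesis
      using as by (auto simp: pred_int_def)
  qed
  then show ?case
    by auto
next
  case (Neg \<phi>)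
  show ?case
    unfolding sat.simps
  proof (intro allI impI notI)
    fix s' assume "(s', s) \<in> ref A" "sat A s' g \<phi>"
    \<comment> \<open>Some refinement of \<open>s'\<close> forces the negation, yet
      \<open>\<phi>\<close> persists to it.\<close>
    then show False
      using Neg.prems(4) sat_persistence ref_refl ref_poss by (metis sat.simps(3))
  qed
next
  case (Conj \<phi> \<psi>)
  have "sat A s g \<phi>"
    by (rule Conj.IH(1)) (use Conj.prems in \<open>fastforce+\<close>)
  moreover have "sat A s g \<psi>"
    by (rule Conj.IH(2)) (use Conj.prems in \<open>fastforce+\<close>)
  ultimately show ?case
    by simp
next
  case (All x \<phi>)
  have "sat A s (g(x := a)) \<phi>" if "a \<in> dom A" for a
  proof (rule All.IH)
    show "\<exists>s''. (s'', s') \<in> ref A \<and> sat A s'' (g(x := a)) \<phi>" if "(s', s) \<in> ref A" for s'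
      using All.prems(4)[OF that] \<open>a \<in> dom A\<close> by auto
  qed (use All.prems that in auto)
  then show ?case
    by simp
qed

section \<open>Substitution as reassignment of a variable\<close>

lemma den_tsubst:
  assumes "is_trm L t" and "s \<in> poss A" and "a \<in> den A s g t"
  shows "den A s g (tsubst x t v) = den A s (g(x := a)) v"
proof (induction v)
  case (Var y)
  then show ?case
    \<comment> \<open>For \<open>y = x\<close> both sides are the equivalence class of
      \<open>a\<close>.\<close>
    using den_eq_class[OF assms] assms(2) by (auto intro: asymp_sym dest: asymp_dom)
next
  case (Fn f ts)
  then have "map (den A s g) (map (tsubst x t) ts) = map (den A s (g(x := a))) ts"
    by (simp del: fun_upd_apply)
  then show ?case
    by (simp only: den.simps tsubst.simps)
qed

text \<open>Since \<open>a\<close> remains in the denotation of \<open>t\<close> at every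
  refinement, the same \<open>a\<close> serves throughout the clauses that quantify over
  refinements.\<close>

lemma sat_subst:
  assumes "is_trm L t" and "s \<in> poss A" and "a \<in> den A s g t" and "free_for t x \<phi>"
  shows "sat A s g (subst x t \<phi>) = sat A s (g(x := a)) \<phi>"
  using assms(2-)
proof (induction \<phi> arbitrary: s g)
  case (Eq u v)
  define h where "h = g(x := a)"
  have "den A s' g (tsubst x t w) = den A s' h w" if "(s', s) \<in> ref A" for s' w
    using den_tsubst den_mono assms(1) Eq.prems(2) that ref_poss unfolding h_def by metis
  then show ?case
    unfolding h_def[symmetric] by (simp add: comp_def)
next
  case (Rel R ts)
  define h where "h = g(x := a)"
  have "den A s' g (tsubst x t w) = den A s' h w" if "(s', s) \<in> ref A" for s' w
    using den_tsubst den_mono assms(1) Rel.prems(2) that ref_poss unfolding h_def by metis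
  then show ?case
    unfolding h_def[symmetric] by (simp add: comp_def)
next
  case (Neg \<phi>)
  define h where "h = g(x := a)"
  have "sat A s' g (subst x t \<phi>) = sat A s' h \<phi>" if "(s', s) \<in> ref A" for s'
    using Neg that den_mono assms(1) ref_poss unfolding h_def by (metis free_for.simps(3))
  then show ?case
    unfolding h_def[symmetric] by simp
next
  case (Conj \<phi> \<psi>)
  then show ?case
    by auto
next
  case (All y \<phi>)
  show ?case
  proof (cases "x \<in> fv (All y \<phi>)")
    case False
    then show ?thesis
      using sat_cong[of "All y \<phi>" g "g(x := a)" A s] subst_not_in_fv[of x "All y \<phi>" t]
      by (metis fun_upd_other)
  next
    case True
    then have y: "y \<noteq> x" "y \<notin> vars t" "free_for t x \<phi>"
      using All.prems(3) by auto
    have "sat A s (g(y := b)) (subst x t \<phi>) = sat A s ((g(x := a))(y := b)) \<phi>" for b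
    proof -
      \<comment> \<open>The absence of capture is used here: reassigning \<open>y\<close> does not
        affect \<open>t\<close>, so \<open>a\<close> still lies in its denotation and the induction
        hypothesis applies to \<open>g(y := b)\<close>.\<close>
      have "den A s (g(y := b)) t = den A s g t"
        using y by (intro den_cong) auto
      then show ?thesis
        using All.IH[of s "g(y := b)"] All.prems y
        by (simp add: fun_upd_twist del: fun_upd_apply)
    qed
    then show ?thesis
      using y by (simp del: fun_upd_apply)
  qed
qed

section \<open>Soundness\<close>

text \<open>The induction varies \<open>s\<close> because \<open>NegI\<close> and \<open>RAA\<close>
  descend to refinements, and \<open>g\<close> because \<open>AllI\<close> reassigns the
  eigenvariable.\<close>

lemma nd_sound:
  assumes "nd L \<Gamma> \<phi>" and "\<forall>\<psi>\<in>\<Gamma>. is_form L \<psi>"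
    and "s \<in> poss A" and "\<forall>x. g x \<in> dom A" and "\<forall>\<psi>\<in>\<Gamma>. sat A s g \<psi>"
  shows "sat A s g \<phi>"
  using assms
proof (induction arbitrary: s g rule: nd.induct)
  case (Assm \<phi> \<Gamma>)
  then show ?case
    by blast
next
  case (NegI \<phi> \<Gamma> \<psi>)
  show ?case
    unfolding sat.simps
  proof (intro allI impI notI)
    fix s' assume s': "(s', s) \<in> ref A" and "sat A s' g \<phi>"
    then have "\<forall>\<chi>\<in>insert \<phi> \<Gamma>. sat A s' g \<chi>"
      using NegI.prems(4) sat_persistence by blast
    moreover have "s' \<in> poss A"
      using s' ref_poss by blast
    ultimately have "sat A s' g \<psi>" "sat A s' g (Neg \<psi>)"
      using NegI.IH NegI.hyps(1) NegI.prems(1,3) by blast+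
    then show False
      using ref_refl \<open>s' \<in> poss A\<close> by auto
  qed
next
  case (RAA \<phi> \<Gamma> \<psi>)
  show ?case
  \<comment> \<open>It suffices to force \<open>\<phi>\<close> densely. If no refinement of
    \<open>s'\<close> forces \<open>\<phi>\<close>, then \<open>s'\<close> forces its negation and
    the two premises clash.\<close>
  proof (rule sat_refinability[OF RAA.hyps(1) RAA.prems(2,3)], rule ccontr)
    fix s' assume s': "(s', s) \<in> ref A"
      and "\<nexists>s''. (s'', s') \<in> ref A \<and> sat A s'' g \<phi>"
    then have "sat A s' g (Neg \<phi>)"
      by auto
    then have "\<forall>\<chi>\<in>insert (Neg \<phi>) \<Gamma>. sat A s' g \<chi>"
      using s' RAA.prems(4) sat_persistence by blast
    moreover have "s' \<in> poss A"
      using s' ref_poss by blast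
    moreover have "\<forall>\<chi>\<in>insert (Neg \<phi>) \<Gamma>. is_form L \<chi>"
      using RAA.hyps(1) RAA.prems(1) by simp
    ultimately have "sat A s' g \<psi>" "sat A s' g (Neg \<psi>)"
      using RAA.IH RAA.prems(3) by blast+
    then show False
      using ref_refl \<open>s' \<in> poss A\<close> by auto
  qed
next
  case (ConjI \<Gamma> \<phi> \<psi>)
  then show ?case
    by simp
next
  case (ConjE1 \<Gamma> \<phi> \<psi>)
  then show ?case
    by auto
next
  case (ConjE2 \<Gamma> \<phi> \<psi>)
  then show ?case
    by auto
next
  case (AllI \<Gamma> x y \<phi>)
  have "sat A s (g(x := a)) \<phi>" if a: "a \<in> dom A" for a
  proof -
    have "\<forall>\<psi>\<in>\<Gamma>. sat A s (g(y := a)) \<psi>"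
    proof
      fix \<psi> assume "\<psi> \<in> \<Gamma>"
      then show "sat A s (g(y := a)) \<psi>"
        using AllI.prems(4) AllI.hyps(4) sat_cong[of \<psi> g "g(y := a)" A s] by fastforce
    qed
    then have "sat A s (g(y := a)) (subst x (Var y) \<phi>)"
      using AllI.IH AllI.prems a by simp
    moreover have "a \<in> den A s (g(y := a)) (Var y)"
      using a asymp_refl AllI.prems(2) by simp
    ultimately have "sat A s ((g(y := a))(x := a)) \<phi>"
      using sat_subst AllI.prems(2) AllI.hyps(2) by (metis is_trm.simps(1))
    \<comment> \<open>Either \<open>y = x\<close>, or \<open>y\<close> is not free in
      \<open>\<phi>\<close>.\<close>
    moreover have "\<forall>z\<in>fv \<phi>. ((g(y := a))(x := a)) z = (g(x := a)) z"
      using AllI.hyps(3) by auto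
    ultimately show ?thesis
      using sat_cong[of \<phi> "g(y := a, x := a)" "g(x := a)" A s] by (simp only:)
  qed
  then show ?case
    by simp
next
  case (AllE \<Gamma> x \<phi> t)
  have "is_form L (subst x t \<phi>)"
    using nd_is_form[OF AllE.hyps(1) AllE.prems(1)] AllE.hyps(2) by (simp add: is_form_subst)
  then show ?case
  proof (rule sat_refinability[OF _ AllE.prems(2,3)])
    fix s' assume s': "(s', s) \<in> ref A"
    \<comment> \<open>\<open>t\<close> may fail to denote at \<open>s'\<close>; at
      \<open>s''\<close> it does, and the instance amounts to \<open>\<phi>\<close> with
      \<open>x\<close> assigned \<open>a\<close>.\<close>
    then obtain s'' a where s'': "(s'', s') \<in> ref A" "a \<in> den A s'' g t"
      using den_eventually_nonempty AllE.hyps(2) AllE.prems(3) ref_poss by (metis all_not_in_conv)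
    have "sat A s'' g (All x \<phi>)"
      using AllE.IH AllE.prems sat_persistence s' s''(1) by blast
    then have "sat A s'' g (subst x t \<phi>)"
      using sat_subst AllE.hyps(2,3) s'' den_dom ref_poss by (metis sat.simps(5))
    then show "\<exists>s''. (s'', s') \<in> ref A \<and> sat A s'' g (subst x t \<phi>)"
      using s''(1) by blast
  qed
next
  case (EqI t \<Gamma>)
  then show ?case
    by simp
next
  case (EqE \<Gamma> t u x \<phi>)
  have tu: "is_trm L t" "is_trm L u"
    using nd_is_form[OF EqE.hyps(1) EqE.prems(1)] by auto
  have "is_form L (subst x u \<phi>)"
    using nd_is_form[OF EqE.hyps(2) EqE.prems(1)] tu by (simp add: is_form_subst)
  then show ?case
  proof (rule sat_refinability[OF _ EqE.prems(2,3)])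
    fix s' assume s': "(s', s) \<in> ref A"
    then obtain s1 a where s1: "(s1, s') \<in> ref A" "a \<in> den A s1 g t"
      using den_eventually_nonempty tu EqE.prems(3) ref_poss by (metis all_not_in_conv)
    \<comment> \<open>First \<open>t\<close>, then \<open>u\<close> is made to denote;
      \<open>a\<close> survives as a value of \<open>t\<close> at \<open>s2\<close>.\<close>
    then obtain s2 where s2: "(s2, s1) \<in> ref A" "den A s2 g u \<noteq> {}"
      using den_eventually_nonempty tu EqE.prems(3) ref_poss by metis
    have s2': "s2 \<in> poss A" "(s2, s) \<in> ref A" "(s2, s') \<in> ref A"
      using s' s1(1) s2(1) ref_trans ref_poss by blast+
    have a: "a \<in> den A s2 g t"
      using den_mono tu s1 s2 by blast
    have "sat A s g (Eq t u)" "sat A s g (subst x t \<phi>)"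
      using EqE.IH EqE.prems by blast+
    then have "den A s2 g t = den A s2 g u" "sat A s2 g (subst x t \<phi>)"
      using s2' s2(2) a sat_persistence by auto
    \<comment> \<open>As \<open>a\<close> lies in the common denotation, both instances are
      equivalent at \<open>s2\<close> to \<open>\<phi>\<close> under
      \<open>g(x := a)\<close>.\<close>
    then have "sat A s2 g (subst x u \<phi>)"
      using sat_subst a tu s2'(1) EqE.hyps(3,4) by metis
    then show "\<exists>s''. (s'', s') \<in> ref A \<and> sat A s'' g (subst x u \<phi>)"
      using s2'(3) by blast
  qed
qed

end

theorem theorem4p2p4:
  fixes L :: "('f, 'p) language"
    and \<Gamma> :: "('f, 'p) form set"
    and \<phi> :: "('f, 'p) form"
    and A :: "('s, 'd, 'f, 'p) pmodel"
    and s :: 's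
    and g :: "nat \<Rightarrow> 'd"
  assumes "\<forall>\<psi>\<in>\<Gamma>. is_form L \<psi>"
    and "is_form L \<phi>"
    and "provable L \<Gamma> \<phi>"
    and "possibility_model L A"
    and "s \<in> poss A"
    and "\<forall>x. g x \<in> dom A"
    and "\<forall>\<psi>\<in>\<Gamma>. sat A s g \<psi>"
  shows "sat A s g \<phi>"
proof -
  obtain \<Gamma>\<^sub>0 where "\<Gamma>\<^sub>0 \<subseteq> \<Gamma>" "nd L \<Gamma>\<^sub>0 \<phi>"
    using assms(3) by (auto simp: provable_def)
  then show ?thesis
    using possibility_model.nd_sound[OF assms(4)] assms by blast
qed

end
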